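(* Let $N\ge 1$ be an integer, let $\mathcal{X}\subset\mathbb{R}^n$ be a state space, and let $\widetilde{\phi}:\mathcal{X}^N\to\mathbb{R}$ be any function (possibly, but not necessarily, differentiable). Define $\phi:\mathcal{X}^N\to\mathbb{R}$ by $$\phi(\mathbf{x})=\sum_{\sigma\in\mathcal{P}_1}\widetilde{\phi}(\sigma(\mathbf{x})),$$ where $\mathcal{P}_1$ is the set of all permutations of the $N$ entries that keep index $1$ fixed. For each $i\in\{1,\dots,N\}$ let $\sigma_{i\to 1}$ be any permutation that moves index $i$ to index $1$, and define $$\gamma_i(\mathbf{x})=\frac{\exp\big(\phi(\sigma_{i\to 1}(\mathbf{x}))\big)}{\sum_{j=1}^N\exp\big(\phi(\sigma_{j\to 1}(\mathbf{x}))\big)},\qquad \mathbf{x}\in\mathcal{X}^N.$$ Then the function $\boldsymbol{\gamma}(\mathbf{x})=[\gamma_1(\mathbf{x}),\dots,\gamma_N(\mathbf{x})]$ satisfies the symmetric responsibility properties, i.e., for all $\mathbf{x}\in\mathcal{X}^N$: (1) $\gamma_i(\mathbf{x})=\gamma_i(\sigma(\mathbf{x}))$ for all $\sigma\in\mathcal{P}_i$ and all $i=1,\dots,N$; (2) $\gamma_i(\mathbf{x})=\gamma_j(\mathbf{x}_{i\leftrightarrow j})$ for all $i,j=1,\dots,N$; (3) $\sum_{i=1}^N\gamma_i(\mathbf{x})=1$.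
   Context: There are $N$ agents with joint state $\mathbf{x}=[x_1,\dots,x_N]\in\mathcal{X}^N$, where $x_i\in\mathcal{X}$ is the state of the agent labeled $i$. A permutation $\sigma$ of the indices $\{1,\dots,N\}$ acts as a map $\sigma:\mathcal{X}^N\to\mathcal{X}^N$ that permutes the ordering of the entries: the entry at index $k$ of $\mathbf{x}$ is moved to index $\sigma(k)$, i.e. $(\sigma(\mathbf{x}))_{\sigma(k)}=x_k$. The set $\mathcal{P}_i$ consists of all permutations of $N$ indices that keep index $i$ fixed. The notation $\sigma_{i\to j}$ denotes any permutation moving index $i$ to index $j$ (the other indices being permuted arbitrarily); in particular the first entry of $\sigma_{i\to 1}(\mathbf{x})$ is $x_i$. The notation $\mathbf{x}_{i\leftrightarrow j}$ denotes $\mathbf{x}$ with the entries at indices $i$ and $j$ swapped (and all other entries unchanged). A responsibility allocation function is a map $\boldsymbol{\gamma}:\mathcal{X}^N\to[0,1]^N$ with components $\gamma_i$; it is called symmetric if properties (1)-(3) in the claim hold. *)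

theory Defs
  imports "HOL-Analysis.Analysis" "HOL-Combinatorics.Permutations"
begin

(* Joint states in X^N are functions on the index set {1..N} that are undefined outside it,
   so that equal tuples are equal functions. *)
definition joint_states :: "nat \<Rightarrow> 'x set \<Rightarrow> (nat \<Rightarrow> 'x) set" where
  "joint_states N X = {1..N} \<rightarrow>\<^sub>E X"

(* The entry at index k moves to index p k, hence the inverse; see permute_state_apply. *)
definition permute_state :: "(nat \<Rightarrow> nat) \<Rightarrow> (nat \<Rightarrow> 'x) \<Rightarrow> (nat \<Rightarrow> 'x)" where
  "permute_state p x = (\<lambda>k. x (inv p k))"

definition swap_entries :: "nat \<Rightarrow> nat \<Rightarrow> (nat \<Rightarrow> 'x) \<Rightarrow> (nat \<Rightarrow> 'x)" where
  "swap_entries i j x = x(i := x j, j := x i)"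

definition perms_fixing :: "nat \<Rightarrow> nat \<Rightarrow> (nat \<Rightarrow> nat) set" where
  "perms_fixing N i = {p. p permutes {1..N} \<and> p i = i}"

definition moves_index :: "nat \<Rightarrow> nat \<Rightarrow> nat \<Rightarrow> (nat \<Rightarrow> nat) \<Rightarrow> bool" where
  "moves_index N i j p \<longleftrightarrow> p permutes {1..N} \<and> p i = j"

definition symmetrized :: "nat \<Rightarrow> ((nat \<Rightarrow> 'x) \<Rightarrow> real) \<Rightarrow> (nat \<Rightarrow> 'x) \<Rightarrow> real" where
  "symmetrized N \<psi> x = (\<Sum>p\<in>perms_fixing N 1. \<psi> (permute_state p x))"

(* s i is the chosen permutation moving index i to index 1. *)
definition softmax_allocation ::
  "nat \<Rightarrow> (nat \<Rightarrow> nat \<Rightarrow> nat) \<Rightarrow> ((nat \<Rightarrow> 'x) \<Rightarrow> real) \<Rightarrow> (nat \<Rightarrow> 'x) \<Rightarrow> nat \<Rightarrow> real" where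
  "softmax_allocation N s \<phi> x i =
     exp (\<phi> (permute_state (s i) x)) / (\<Sum>j=1..N. exp (\<phi> (permute_state (s j) x)))"

definition responsibility_allocation ::
  "nat \<Rightarrow> 'x set \<Rightarrow> ((nat \<Rightarrow> 'x) \<Rightarrow> nat \<Rightarrow> real) \<Rightarrow> bool" where
  "responsibility_allocation N X \<gamma> \<longleftrightarrow> (\<forall>x\<in>joint_states N X. \<forall>i\<in>{1..N}. \<gamma> x i \<in> {0..1})"

definition symmetric_responsibility ::
  "nat \<Rightarrow> 'x set \<Rightarrow> ((nat \<Rightarrow> 'x) \<Rightarrow> nat \<Rightarrow> real) \<Rightarrow> bool" where
  "symmetric_responsibility N X \<gamma> \<longleftrightarrow>
     responsibility_allocation N X \<gamma> \<and>
     (\<forall>x\<in>joint_states N X.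
        (\<forall>i\<in>{1..N}. \<forall>p\<in>perms_fixing N i. \<gamma> x i = \<gamma> (permute_state p x) i) \<and>
        (\<forall>i\<in>{1..N}. \<forall>j\<in>{1..N}. \<gamma> x i = \<gamma> (swap_entries i j x) j) \<and>
        (\<Sum>i=1..N. \<gamma> x i) = 1)"

lemma permute_state_apply:
  assumes "p permutes {1..N}"
  shows "permute_state p x (p k) = x k"
  using permutes_inverses(2)[OF assms] by (simp add: permute_state_def)

lemma permute_state_in_joint_states:
  assumes "p permutes {1..N}" and "x \<in> joint_states N X"
  shows "permute_state p x \<in> joint_states N X"
proof -
  have i: "inv p k \<in> {1..N} \<longleftrightarrow> k \<in> {1..N}" for k
    using permutes_in_image[OF permutes_inv[OF assms(1)]] .
  show ?thesis
    using assms(2) i unfolding joint_states_def permute_state_def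
    by (auto simp: PiE_iff extensional_def simp del: atLeastAtMost_iff)
qed

lemma swap_entries_in_joint_states:
  assumes "i \<in> {1..N}" and "j \<in> {1..N}" and "x \<in> joint_states N X"
  shows "swap_entries i j x \<in> joint_states N X"
  using assms unfolding joint_states_def swap_entries_def
  by (auto simp: PiE_iff extensional_def)

end

theory Submission
  imports Defs
begin

text \<open>Permuting the joint state by p carries the score of agent i to the score of agent p i, since
  s (p i) and p compose to a permutation moving i to 1, and the symmetrized potential does not
  depend on which such permutation is used. Hence the softmax allocation is equivariant under all
  permutations; properties (1) and (2) are the cases where p fixes i or transposes i and j.\<close>

text \<open>The inverse in \<open>permute_state\<close> makes this a left action:
  \<open>inv (p \<circ> q)\<close> is \<open>inv q \<circ> inv p\<close>, and precomposition
  reverses the order once more.\<close>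

lemma permute_state_compose:
  assumes "p permutes S" and "q permutes S"
  shows "permute_state p (permute_state q x) = permute_state (p \<circ> q) x"
  using o_inv_distrib[OF permutes_bij[OF assms(1)] permutes_bij[OF assms(2)]]
  by (simp add: permute_state_def)

lemma permute_state_transpose: "permute_state (Transposition.transpose i j) x = swap_entries i j x"
  by (auto simp: permute_state_def swap_entries_def Transposition.transpose_def fun_eq_iff)

lemma perms_fixing_compose:
  assumes "p \<in> perms_fixing N i" and "q \<in> perms_fixing N i"
  shows "p \<circ> q \<in> perms_fixing N i"
  using assms by (auto simp: perms_fixing_def intro: permutes_compose)

lemma perms_fixing_inv:
  assumes "p \<in> perms_fixing N i"
  shows "inv p \<in> perms_fixing N i"
  using assms by (auto simp: perms_fixing_def permutes_inv permutes_inv_eq)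

text \<open>\<open>perms_fixing N 1\<close> is a group, so right translation by \<open>a\<close> is
  a bijection of it onto itself, with right translation by \<open>inv a\<close> as its inverse.
  Acting by \<open>a\<close> therefore only reorders the summands.\<close>

lemma symmetrized_permute_state:
  assumes a: "a \<in> perms_fixing N 1"
  shows "symmetrized N \<psi> (permute_state a x) = symmetrized N \<psi> x"
proof -
  have pa: "a permutes {1..N}"
    using a by (simp add: perms_fixing_def)
  have "(\<Sum>p\<in>perms_fixing N 1. \<psi> (permute_state p (permute_state a x))) =
        (\<Sum>p\<in>perms_fixing N 1. \<psi> (permute_state p x))"
  proof (rule sum.reindex_bij_witness[where i = "\<lambda>p. p \<circ> inv a" and j = "\<lambda>p. p \<circ> a"])
    fix p assume p: "p \<in> perms_fixing N 1"
    show "p \<circ> a \<circ> inv a = p" "p \<circ> inv a \<circ> a = p"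
      by (simp_all add: comp_assoc permutes_inv_o[OF pa])
    show "p \<circ> a \<in> perms_fixing N 1" "p \<circ> inv a \<in> perms_fixing N 1"
      using p a by (simp_all add: perms_fixing_compose perms_fixing_inv)
    show "\<psi> (permute_state (p \<circ> a) x) = \<psi> (permute_state p (permute_state a x))"
      using p pa permute_state_compose[of p "{1..N}" a x] by (simp add: perms_fixing_def)
  qed
  then show ?thesis
    by (simp add: symmetrized_def)
qed

text \<open>This makes the allocation independent of the choice of \<open>s\<close>: two
  permutations moving \<open>i\<close> to 1 differ by a left factor fixing 1, which the
  symmetrization absorbs.\<close>

lemma symmetrized_moves_index_cong:
  assumes "moves_index N i 1 p" and "moves_index N i 1 q"
  shows "symmetrized N \<psi> (permute_state p x) = symmetrized N \<psi> (permute_state q x)"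
proof -
  have p: "p permutes {1..N}" "p i = 1" and q: "q permutes {1..N}" "q i = 1"
    using assms by (auto simp: moves_index_def)
  have "inv p 1 = i"
    using p by (simp add: permutes_inv_eq)
  \<comment> \<open>\<open>inv p\<close> sends 1 back to \<open>i\<close>, and \<open>q\<close>
    sends \<open>i\<close> to 1 again.\<close>
  then have fixing: "q \<circ> inv p \<in> perms_fixing N 1"
    using p q by (simp add: perms_fixing_def permutes_compose permutes_inv)
  have "permute_state (q \<circ> inv p) (permute_state p x) = permute_state (q \<circ> inv p \<circ> p) x"
    using p q by (intro permute_state_compose[of _ "{1..N}"] permutes_compose permutes_inv)
  also have "\<dots> = permute_state q x"
    by (simp add: comp_assoc permutes_inv_o[OF p(1)])
  finally show ?thesis
    using symmetrized_permute_state[OF fixing] by metis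
qed

lemma softmax_allocation_equivariant:
  assumes s: "\<And>i. i \<in> {1..N} \<Longrightarrow> moves_index N i 1 (s i)"
    and p: "p permutes {1..N}" and i: "i \<in> {1..N}"
  shows "softmax_allocation N s (symmetrized N \<psi>) (permute_state p x) (p i) =
         softmax_allocation N s (symmetrized N \<psi>) x i"
proof -
  let ?e = "\<lambda>x j. exp (symmetrized N \<psi> (permute_state (s j) x))"
  have e: "?e (permute_state p x) (p j) = ?e x j" if j: "j \<in> {1..N}" for j
  proof -
    have pj: "p j \<in> {1..N}"
      using permutes_in_image[OF p] j by blast
    have sp: "s (p j) permutes {1..N}"
      using s[OF pj] by (simp add: moves_index_def)
    have "moves_index N j 1 (s (p j) \<circ> p)"
      using s[OF pj] p by (auto simp: moves_index_def intro: permutes_compose)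
    from symmetrized_moves_index_cong[OF this s[OF j]] show ?thesis
      by (simp add: permute_state_compose[OF sp p])
  qed
  \<comment> \<open>The normalizing sum runs over all agents, so relabeling them by \<open>p\<close>
    leaves it unchanged; numerator and denominator can then be compared separately.\<close>
  have "(\<Sum>j=1..N. ?e (permute_state p x) j) = (\<Sum>j=1..N. ?e (permute_state p x) (p j))"
    using sum.permute[OF p, of "?e (permute_state p x)"] by (simp add: comp_def)
  also have "\<dots> = (\<Sum>j=1..N. ?e x j)"
    using e by (intro sum.cong) auto
  finally show ?thesis
    using e[OF i] by (simp add: softmax_allocation_def)
qed

text \<open>All agents share one denominator, and it cancels because a nonempty sum of exponentials
  is positive.\<close>

lemma softmax_allocation_sum:
  assumes "N \<ge> 1"
  shows "(\<Sum>i=1..N. softmax_allocation N s \<phi> x i) = 1"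
proof -
  have "(\<Sum>j=1..N. exp (\<phi> (permute_state (s j) x))) > 0"
    using assms by (intro sum_pos) auto
  then show ?thesis
    by (simp add: softmax_allocation_def flip: sum_divide_distrib)
qed

text \<open>A nonnegative summand is at most the total, which is 1; membership of \<open>i\<close>
  in the index set yields \<open>N \<ge> 1\<close>.\<close>

lemma softmax_allocation_in_unit_interval:
  assumes i: "i \<in> {1..N}"
  shows "softmax_allocation N s \<phi> x i \<in> {0..1}"
proof -
  have nonneg: "softmax_allocation N s \<phi> x j \<ge> 0" for j
    by (simp add: softmax_allocation_def sum_nonneg)
  have "softmax_allocation N s \<phi> x i \<le> (\<Sum>j=1..N. softmax_allocation N s \<phi> x j)"
    using i nonneg by (intro member_le_sum) auto
  also have "\<dots> = 1"
    using i by (intro softmax_allocation_sum) auto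
  finally show ?thesis
    using nonneg by simp
qed

theorem proposition1:
  fixes N :: nat
    and X :: "(real ^ 'n) set"
    and \<psi> :: "(nat \<Rightarrow> real ^ 'n) \<Rightarrow> real"
    and s :: "nat \<Rightarrow> nat \<Rightarrow> nat"
  assumes "N \<ge> 1"
    and "\<And>i. i \<in> {1..N} \<Longrightarrow> moves_index N i 1 (s i)"
  shows "symmetric_responsibility N X (softmax_allocation N s (symmetrized N \<psi>))"
proof -
  let ?\<gamma> = "softmax_allocation N s (symmetrized N \<psi>)"
  note equivariant = softmax_allocation_equivariant[OF assms(2), where \<psi> = \<psi>]
  have "?\<gamma> x i = ?\<gamma> (permute_state p x) i" if "i \<in> {1..N}" "p \<in> perms_fixing N i" for x i p
    using equivariant[of p i x] that by (simp add: perms_fixing_def)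
  moreover have "?\<gamma> x i = ?\<gamma> (swap_entries i j x) j" if "i \<in> {1..N}" "j \<in> {1..N}" for x i j
    \<comment> \<open>The transposition sends \<open>i\<close> to \<open>j\<close>; for
      \<open>i = j\<close> it is the identity, so that case needs no separate argument.\<close>
    using equivariant[OF _ permutes_swap_id[OF that] that(1), of x]
    by (simp add: permute_state_transpose)
  ultimately show ?thesis
    unfolding symmetric_responsibility_def responsibility_allocation_def
    using softmax_allocation_in_unit_interval softmax_allocation_sum[OF assms(1)] by blast
qed

end
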